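(* Let $\mu_1, \ldots, \mu_n$ be finite absolutely continuous measures on $\mathbb{R}^d$ whose supports $K_1, \ldots, K_n$ are nicely separated, and let $\alpha_1, \ldots, \alpha_n$ be real numbers in $(0,1)$. Then there exists a polyhedron $P$ with at most $n$ facets such that $\mu_i(P) = \alpha_i \cdot \mu_i(\mathbb{R}^d)$ for every $1 \le i \le n$.
   Context: A measure $\mu$ on $\mathbb{R}^d$ with support $K$ is called absolutely continuous if it is absolutely continuous with respect to the Lebesgue measure, the interior of $K$ is nonempty and connected, and $\mu(U) > 0$ for every open set $U \subset K$. The supports $K_1,\ldots,K_n$ are nicely separated if for each $1 \le i \le n$ there exists a hyperplane $H_i$, with closed half-spaces $H_i^+$ and $H_i^-$, such that $K_i \cap H_i^+ = \emptyset$ and $K_j \cap H_i^- = \emptyset$ for all $j \neq i$. A polyhedron is a finite intersection of closed half-spaces; a facet is a $(d-1)$-dimensional face. *)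

theory Defs
  imports "HOL-Analysis.Analysis"
begin

definition msupport :: "'a::topological_space measure \<Rightarrow> 'a set" where
  "msupport M = {x. \<forall>U. open U \<longrightarrow> x \<in> U \<longrightarrow> emeasure M U > 0}"

(* Stronger than the library's absolutely_continuous, which it contains. The last clause
   excludes the empty open set, for which it would fail. *)
definition abs_cont_measure :: "'a::euclidean_space measure \<Rightarrow> bool" where
  "abs_cont_measure M \<longleftrightarrow>
     absolutely_continuous lborel M \<and>
     interior (msupport M) \<noteq> {} \<and> connected (interior (msupport M)) \<and>
     (\<forall>U. open U \<longrightarrow> U \<noteq> {} \<longrightarrow> U \<subseteq> msupport M \<longrightarrow> emeasure M U > 0)"

(* The hyperplane H i is {x. a \<bullet> x = b}; replacing (a, b) by (-a, -b) swaps its two closed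
   half-spaces, so fixing which of them is the positive one loses no generality. *)
definition nicely_separated :: "nat \<Rightarrow> (nat \<Rightarrow> 'a::euclidean_space set) \<Rightarrow> bool" where
  "nicely_separated n K \<longleftrightarrow>
     (\<forall>i\<in>{1..n}. \<exists>a b. a \<noteq> 0 \<and>
        K i \<inter> {x. a \<bullet> x \<ge> b} = {} \<and>
        (\<forall>j\<in>{1..n}. j \<noteq> i \<longrightarrow> K j \<inter> {x. a \<bullet> x \<le> b} = {}))"

(* The dimension d - 1 refers to the ambient space, whereas the library's facet_of
   refers to the affine dimension of P; the two agree when P has nonempty interior. *)
definition facets :: "'a::euclidean_space set \<Rightarrow> 'a set set" where
  "facets P = {F. F face_of P \<and> aff_dim F = int DIM('a) - 1}"

end

(* For each i the half-space {x. a i \<bullet> x \<ge> t} contains every support other than K i as long as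
   its boundary is a translate of H i towards K i. Its \<mu> i measure is continuous in t, since
   hyperplanes are null, so some translate cuts off exactly the prescribed part of \<mu> i. The
   intersection of these n half-spaces works: only the i-th one cuts K i. *)
theory Submission
  imports Defs "HOL-Probability.Distribution_Functions"
begin

text \<open>The complement of the support is a union of open null sets. Second countability
  (Lindelof) reduces it to a countable union, which is still null.\<close>

lemma Compl_msupport_null_sets:
  fixes M :: "'a::second_countable_topology measure"
  assumes M: "sets M = sets borel"
  shows "- msupport M \<in> null_sets M"
proof -
  let ?\<U> = "{U. open U \<and> emeasure M U = 0}"
  have eq: "- msupport M = \<Union>?\<U>"
    by (auto simp: msupport_def not_gr_zero)
  obtain \<V> where \<V>: "\<V> \<subseteq> ?\<U>" "countable \<V>" "\<Union>\<V> = \<Union>?\<U>"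
    using Lindelof[of ?\<U>] by auto
  have "(\<Union>U\<in>\<V>. U) \<in> null_sets M"
  proof (rule null_sets_UN')
    show "U \<in> null_sets M" if "U \<in> \<V>" for U
      using subsetD[OF \<V>(1) that] M by (auto simp: null_sets_def)
  qed (rule \<V>(2))
  then show ?thesis
    using \<V>(3) eq by simp
qed

text \<open>Intermediate value theorem for the mass of a half-space as a function of its offset,
  obtained from the distribution function of a linear functional.\<close>

lemma exists_halfspace_measure_eq:
  fixes M :: "'a::euclidean_space measure"
  assumes M: "sets M = sets borel" and fin: "finite_measure M"
    and ac: "absolutely_continuous lborel M"
    and a: "a \<noteq> 0" and c: "0 < c" "c < measure M UNIV"
  shows "\<exists>t. measure M {x. t \<le> a \<bullet> x} = c"
proof -
  interpret finite_measure M by fact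
  have space: "space M = UNIV"
    using sets_eq_imp_space_eq[OF M] by simp
  \<comment> \<open>The sign turns the half-space {x. -s \<le> a \<bullet> x} into the lower ray up
    to s, so its mass is exactly \<open>cdf N s\<close>.\<close>
  define N where "N = distr M borel (\<lambda>x. - (a \<bullet> x))"
  have meas [measurable]: "(\<lambda>x. - (a \<bullet> x)) \<in> M \<rightarrow>\<^sub>M borel"
    by (simp add: measurable_cong_sets[OF M refl])
  interpret N: finite_borel_measure N
    unfolding finite_borel_measure_def finite_borel_measure_axioms_def N_def
    by (simp add: finite_measure_distr[OF meas])
  have measN: "measure N A = measure M {x. - (a \<bullet> x) \<in> A}" if "A \<in> sets borel" for A
    using that unfolding N_def by (simp add: measure_distr[OF meas] space vimage_def)
  \<comment> \<open>An atom of \<open>N\<close> at s would be a hyperplane of positive mass;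
    hyperplanes are Lebesgue null, hence null for \<open>M\<close>, so \<open>cdf N\<close> is
    continuous.\<close>
  have "{x. - (a \<bullet> x) = s} \<in> null_sets M" for s
  proof -
    have "{x. - (a \<bullet> x) = s} = {x. a \<bullet> x = - s}"
      by auto
    moreover have "{x. a \<bullet> x = - s} \<in> null_sets lborel"
      using negligible_hyperplane[of a "- s"] a
      by (simp add: negligible_iff_null_sets null_sets_completion_iff borel_closed closed_hyperplane)
    ultimately show ?thesis
      using ac by (auto simp: absolutely_continuous_def)
  qed
  then have cont: "isCont (cdf N) s" for s
    using measN[of "{s}"] by (simp add: N.isCont_cdf measure_eq_0_null_sets)
  have "eventually (\<lambda>s. cdf N s < c) at_bot"
    using order_tendstoD(2)[OF N.cdf_lim_at_bot c(1)] .
  then obtain u where u: "\<And>s. s \<le> u \<Longrightarrow> cdf N s < c"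
    by (auto simp: eventually_at_bot_linorder)
  have "c < measure N (space N)"
    using c(2) measN[of UNIV] N.borel_UNIV by simp
  then have "eventually (\<lambda>s. c < cdf N s) at_top"
    using order_tendstoD(1)[OF N.cdf_lim_at_top] by blast
  then obtain v where v: "\<And>s. v \<le> s \<Longrightarrow> c < cdf N s"
    by (auto simp: eventually_at_top_linorder)
  \<comment> \<open>Taking \<open>max u v\<close> ensures that the interval for the intermediate
    value theorem is not reversed.\<close>
  obtain s where "cdf N s = c"
    using IVT[of "cdf N" u c "max u v"] less_imp_le[OF u[of u]] less_imp_le[OF v[of "max u v"]] cont
    by auto
  then have "measure M {x. - s \<le> a \<bullet> x} = c"
    by (simp add: cdf_def measN minus_le_iff)
  then show ?thesis ..
qed

text \<open>A face of dimension d - 1 must lie in the boundary hyperplane of some constraint, and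
  then it fills the whole face cut out by that hyperplane. The argument covers \<open>P\<close> with
  empty interior, where \<open>P\<close> itself can be a member of \<open>facets P\<close>.\<close>

lemma facets_halfspaces_subset:
  fixes a :: "'i \<Rightarrow> 'a::euclidean_space" and t :: "'i \<Rightarrow> real"
  assumes I: "finite I" and a: "\<And>i. i \<in> I \<Longrightarrow> a i \<noteq> 0"
  defines "P \<equiv> \<Inter>i\<in>I. {x. t i \<le> a i \<bullet> x}"
  shows "facets P \<subseteq> (\<lambda>i. P \<inter> {x. a i \<bullet> x = t i}) ` I"
proof
  fix F assume "F \<in> facets P"
  then have F: "F face_of P" and dim: "aff_dim F = int DIM('a) - 1"
    by (auto simp: facets_def)
  have convP: "convex P"
    unfolding P_def by (auto intro: convex_INT convex_halfspace_ge)
  \<comment> \<open>Since d \<ge> 1, the dimension of \<open>F\<close> is at least 0, whereas the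
    empty set has dimension -1.\<close>
  have "F \<noteq> {}"
    using dim DIM_positive[where 'a='a] by (auto simp del: DIM_positive)
  (* The constraint tight at z is tight on all of F, because z is relatively interior. *)
  then obtain z where z: "z \<in> rel_interior F"
    using rel_interior_eq_empty[OF face_of_imp_convex[OF F]] by auto
  then have zF: "z \<in> F"
    using rel_interior_subset by auto
  have zP: "z \<in> P"
    using zF face_of_imp_subset[OF F] by auto
  have "z \<notin> interior P"
  proof (cases "F = P")
    case True
    then have "interior P = {}"
      using aff_dim_nonempty_interior[of P] dim by auto
    then show ?thesis by simp
  next
    case False
    then show ?thesis
      using face_of_disjoint_interior[OF F] zF by auto
  qed
  \<comment> \<open>Finitely many strict constraints define an open neighbourhood of
    \<open>z\<close> inside \<open>P\<close>; so at a point outside the interior some constraint is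
    tight.\<close>
  moreover have "z \<in> interior P" if "\<And>i. i \<in> I \<Longrightarrow> t i < a i \<bullet> z"
  proof (rule interiorI)
    show "open (\<Inter>i\<in>I. {x. t i < a i \<bullet> x})"
      using I by (intro open_INT) (auto simp: open_halfspace_gt)
    show "z \<in> (\<Inter>i\<in>I. {x. t i < a i \<bullet> x})"
      using that by auto
    show "(\<Inter>i\<in>I. {x. t i < a i \<bullet> x}) \<subseteq> P"
      unfolding P_def by (auto intro: less_imp_le)
  qed
  ultimately obtain i where i: "i \<in> I" "\<not> t i < a i \<bullet> z"
    by blast
  then have zi: "a i \<bullet> z = t i"
    using zP by (force simp: P_def)
  define G where "G = P \<inter> {x. a i \<bullet> x = t i}"
  have G: "G face_of P"
    unfolding G_def using convP i(1)
    by (intro face_of_Int_supporting_hyperplane_ge) (auto simp: P_def)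
  have "F \<subseteq> G"
    using z zP zi by (intro subset_of_face_of[OF G face_of_imp_subset[OF F]]) (auto simp: G_def)
  then have "F face_of G"
    using face_of_subset[OF F _ face_of_imp_subset[OF G]] by blast
  \<comment> \<open>\<open>G\<close> lies in a hyperplane, so its dimension is at most d - 1; a
    proper face of \<open>G\<close> would have strictly smaller dimension than
    \<open>G\<close>.\<close>
  moreover have "aff_dim G \<le> aff_dim F"
    using aff_dim_subset[of G "{x. a i \<bullet> x = t i}"] a[OF i(1)] dim by (simp add: G_def)
  ultimately have "F = G"
    using face_of_aff_dim_lt[OF face_of_imp_convex[OF G]] by force
  then show "F \<in> (\<lambda>i. P \<inter> {x. a i \<bullet> x = t i}) ` I"
    using i(1) by (auto simp: G_def)
qed

theorem theorem5p2:
  fixes M :: "nat \<Rightarrow> 'a::euclidean_space measure"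
    and \<alpha> :: "nat \<Rightarrow> real"
    and n :: nat
  assumes "\<And>i. i \<in> {1..n} \<Longrightarrow> sets (M i) = sets borel"
    and "\<And>i. i \<in> {1..n} \<Longrightarrow> finite_measure (M i)"
    and "\<And>i. i \<in> {1..n} \<Longrightarrow> abs_cont_measure (M i)"
    and "nicely_separated n (\<lambda>i. msupport (M i))"
    and "\<And>i. i \<in> {1..n} \<Longrightarrow> 0 < \<alpha> i \<and> \<alpha> i < 1"
  shows "\<exists>P. polyhedron P \<and> finite (facets P) \<and> card (facets P) \<le> n \<and>
           (\<forall>i\<in>{1..n}. measure (M i) P = \<alpha> i * measure (M i) UNIV)"
proof -
  define K where "K = (\<lambda>i. msupport (M i))"
  have Knull: "- K i \<in> null_sets (M i)" if "i \<in> {1..n}" for i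
    unfolding K_def by (rule Compl_msupport_null_sets[OF assms(1)[OF that]])
  have pos: "0 < \<alpha> i * measure (M i) UNIV" "\<alpha> i * measure (M i) UNIV < measure (M i) UNIV"
    if i: "i \<in> {1..n}" for i
  proof -
    interpret finite_measure "M i" by (rule assms(2)[OF i])
    \<comment> \<open>The interior of the support is itself a nonempty open subset of the support,
      so it has positive mass.\<close>
    have "0 < emeasure (M i) (interior (K i))"
      using assms(3)[OF i] interior_subset unfolding abs_cont_measure_def K_def by blast
    also have "\<dots> \<le> emeasure (M i) UNIV"
      by (intro emeasure_mono) (auto simp: assms(1)[OF i])
    finally have "0 < measure (M i) UNIV"
      by (simp add: emeasure_eq_measure)
    then show "0 < \<alpha> i * measure (M i) UNIV" "\<alpha> i * measure (M i) UNIV < measure (M i) UNIV"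
      using assms(5)[OF i] by auto
  qed
  have "\<exists>a t. a \<noteq> 0 \<and> measure (M i) {x. t \<le> a \<bullet> x} = \<alpha> i * measure (M i) UNIV \<and>
              (\<forall>j\<in>{1..n}. j \<noteq> i \<longrightarrow> K j \<subseteq> {x. t \<le> a \<bullet> x})"
    if i: "i \<in> {1..n}" for i
  proof -
    obtain a b where a: "a \<noteq> 0" and Ki: "K i \<inter> {x. a \<bullet> x \<ge> b} = {}"
      and Kj: "\<And>j. j \<in> {1..n} \<Longrightarrow> j \<noteq> i \<Longrightarrow> K j \<inter> {x. a \<bullet> x \<le> b} = {}"
      using bspec[OF assms(4)[unfolded nicely_separated_def, folded K_def] i]
      unfolding K_def by auto
    obtain t where t: "measure (M i) {x. t \<le> a \<bullet> x} = \<alpha> i * measure (M i) UNIV"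
      using exists_halfspace_measure_eq[OF assms(1)[OF i] assms(2)[OF i] _ a pos[OF i]]
        assms(3)[OF i] by (auto simp: abs_cont_measure_def)
    \<comment> \<open>For t > b the half-space would miss \<open>K i\<close> and have mass 0, not
      the positive prescribed mass. With t \<le> b it contains the whole side a \<bullet> x > b,
      where the other supports lie.\<close>
    have "t \<le> b"
    proof (rule ccontr)
      assume "\<not> t \<le> b"
      then have "{x. t \<le> a \<bullet> x} \<subseteq> - K i"
        using Ki by force
      then have "{x. t \<le> a \<bullet> x} \<in> null_sets (M i)"
        by (rule null_sets_subset[OF Knull[OF i], rotated])
          (simp add: assms(1)[OF i] borel_closed closed_halfspace_ge)
      then show False
        using t pos(1)[OF i] measure_eq_0_null_sets by fastforce
    qed
    then have "\<forall>j\<in>{1..n}. j \<noteq> i \<longrightarrow> K j \<subseteq> {x. t \<le> a \<bullet> x}"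
      using Kj by fastforce
    then show ?thesis
      using a t by blast
  qed
  then obtain a t where "\<And>i. i \<in> {1..n} \<Longrightarrow> a i \<noteq> 0 \<and>
      measure (M i) {x. t i \<le> a i \<bullet> x} = \<alpha> i * measure (M i) UNIV \<and>
      (\<forall>j\<in>{1..n}. j \<noteq> i \<longrightarrow> K j \<subseteq> {x. t i \<le> a i \<bullet> x})"
    by metis
  then have a: "\<And>i. i \<in> {1..n} \<Longrightarrow> a i \<noteq> 0"
    and cut: "\<And>i. i \<in> {1..n} \<Longrightarrow> measure (M i) {x. t i \<le> a i \<bullet> x} = \<alpha> i * measure (M i) UNIV"
    and sub: "\<And>i j. i \<in> {1..n} \<Longrightarrow> j \<in> {1..n} \<Longrightarrow> j \<noteq> i \<Longrightarrow> K j \<subseteq> {x. t i \<le> a i \<bullet> x}"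
    by blast+
  define P where "P = (\<Inter>i\<in>{1..n}. {x. t i \<le> a i \<bullet> x})"
  have poly: "polyhedron P"
    unfolding P_def by (rule polyhedron_Inter) (auto simp: polyhedron_halfspace_ge)
  have facets: "facets P \<subseteq> (\<lambda>i. P \<inter> {x. a i \<bullet> x = t i}) ` {1..n}"
    unfolding P_def using a by (intro facets_halfspaces_subset) auto
  have fin: "finite (facets P)"
    by (rule finite_subset[OF facets]) simp
  have card: "card (facets P) \<le> n"
    using surj_card_le[OF _ facets] by simp
  have "measure (M i) P = \<alpha> i * measure (M i) UNIV" if i: "i \<in> {1..n}" for i
  proof -
    have "measure (M i) P = measure (M i) {x. t i \<le> a i \<bullet> x}"
    proof (rule measure_eq_AE)
      \<comment> \<open>Almost every x lies in \<open>K i\<close>, where all constraints with index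
        j \<noteq> i hold automatically; membership in \<open>P\<close> then depends on the i-th one
        alone.\<close>
      show "AE x in M i. (x \<in> P) = (x \<in> {x. t i \<le> a i \<bullet> x})"
        using AE_not_in[OF Knull[OF i]]
      proof eventually_elim
        case (elim x)
        then have "t j \<le> a j \<bullet> x" if "j \<in> {1..n}" "j \<noteq> i" for j
          using sub[OF that(1) i] that(2) by auto
        then show ?case
          using i unfolding P_def by blast
      qed
      show "P \<in> sets (M i)" "{x. t i \<le> a i \<bullet> x} \<in> sets (M i)"
        by (simp_all add: assms(1)[OF i] borel_closed closed_halfspace_ge
            polyhedron_imp_closed[OF poly])
    qed
    then show ?thesis
      using cut[OF i] by simp
  qed
  then show ?thesis
    using poly fin card by blast
qed

end
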